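(* $\mathsf{colength}\,\mathsf{sieve}=\omega_{\mathbb{N}}$.
   Context: Conats $\overline{\mathbb{N}}$: coinductive with $\mathsf{cozero}$, $\mathsf{cosucc}$, ordered coinductively by $\mathsf{cozero}\sqsubseteq n$ and $\mathsf{cosucc}\,n\sqsubseteq\mathsf{cosucc}\,m$ if $n\sqsubseteq m$; $\omega_{\mathbb{N}}:=\mathsf{cosucc}\,\omega_{\mathbb{N}}$; order-equivalent conats are assumed equal (axiom). $\mathsf{colist}\,A$: coinductive with $\bot$, $\mathsf{cocons}\,a\,l$, ordered by $\bot\sqsubseteq l$ and $\mathsf{cocons}\,a\,l_1\sqsubseteq\mathsf{cocons}\,a\,l_2$ if $l_1\sqsubseteq l_2$; order-equivalent streams are assumed equal. $\mathsf{idl}\,s\,0=\mathsf{nil}$, $\mathsf{idl}\,\bot\,(i+1)=\mathsf{nil}$, $\mathsf{idl}(\mathsf{cocons}\,a\,s)(i+1)=\mathsf{cons}\,a\,(\mathsf{idl}\,s\,i)$. For monotone $h:\mathsf{list}\,A\to C$ (prefix order), $\overline h(s):=\sup_i h(\mathsf{idl}\,s\,i)$ (chosen supremum). $\mathsf{fold}\,z\,f$: $\mathsf{nil}\mapsto z$, $\mathsf{cons}\,a\,l\mapsto f\,a\,(\mathsf{fold}\,z\,f\,l)$. $\mathsf{colength}:=\overline{\mathsf{fold}\,\mathsf{cozero}\,(\lambda\_.\,\mathsf{cosucc})}:\mathsf{colist}\,A\to\overline{\mathbb{N}}$. $\mathsf{filter}\,f:=\overline{\mathsf{fold}\,\bot\,(\lambda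 a\,l.\,\text{if }f\,a\text{ then }\mathsf{cocons}\,a\,l\text{ else }l)}$. $\mathsf{nats}\,n:=\mathsf{cocons}\,n\,(\mathsf{nats}(n+1))$, $n:\mathbb{Z}$. $\mathsf{sieve\_aux}:=\overline{\mathsf{fold}\,\bot\,(\lambda n\,l.\,\mathsf{cocons}\,n\,(\mathsf{filter}\,(\lambda m.\,m\bmod n\ne0)\,l))}$, $\mathsf{sieve}:=\mathsf{sieve\_aux}(\mathsf{nats}\,2)$. *)

theory Defs
  imports Main "HOL-Library.Sublist"
begin

codatatype conat = cozero | cosucc conat

primcorec conat_omega :: conat where
  "conat_omega = cosucc conat_omega"

codatatype 'a colist = cobot | cocons (cohd: 'a) (cotl: "'a colist")

text \<open>Equality on a codatatype is bisimilarity, so the identification of order-equivalent conats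
  (resp. colists) is a theorem here: it is the antisymmetry part of the \<open>ccpo\<close> instances below.
  The operation \<open>Sup\<close> of these instances is the chosen supremum of chains.\<close>

coinductive conat_le :: "conat \<Rightarrow> conat \<Rightarrow> bool" where
  cozero_le: "conat_le cozero n"
| cosucc_le: "conat_le n m \<Longrightarrow> conat_le (cosucc n) (cosucc m)"

coinductive colist_le :: "'a colist \<Rightarrow> 'a colist \<Rightarrow> bool" where
  cobot_le: "colist_le cobot l"
| cocons_le: "colist_le l1 l2 \<Longrightarrow> colist_le (cocons a l1) (cocons a l2)"

inductive_simps conat_le_simps [simp]:
  "conat_le cozero n" "conat_le (cosucc n) cozero" "conat_le (cosucc n) (cosucc m)"
inductive_simps colist_le_simps [simp]:
  "colist_le cobot l" "colist_le (cocons a l) cobot" "colist_le (cocons a l) (cocons b l')"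

primcorec conat_Sup :: "conat set \<Rightarrow> conat" where
  "conat_Sup A = (if A \<subseteq> {cozero} then cozero else cosucc (conat_Sup {n. cosucc n \<in> A}))"

primcorec colist_Sup :: "'a colist set \<Rightarrow> 'a colist" where
  "colist_Sup A = (if A \<subseteq> {cobot} then cobot
     else cocons (SOME a. \<exists>l. cocons a l \<in> A) (colist_Sup {l. \<exists>a. cocons a l \<in> A}))"

lemma conat_le_refl: "conat_le n n"
proof (coinduction arbitrary: n)
  case conat_le
  then show ?case by (cases n) auto
qed

lemma conat_le_trans: "conat_le k n \<Longrightarrow> conat_le n m \<Longrightarrow> conat_le k m"
proof (coinduction arbitrary: k n m)
  case conat_le
  then show ?case by (cases k; cases n; cases m) auto
qed

lemma conat_le_antisym: "conat_le n m \<Longrightarrow> conat_le m n \<Longrightarrow> n = m"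
proof (coinduction arbitrary: n m)
  case Eq_conat
  then show ?case by (cases n; cases m) auto
qed

lemma colist_le_refl: "colist_le l l"
proof (coinduction arbitrary: l)
  case colist_le
  then show ?case by (cases l) auto
qed

lemma colist_le_trans: "colist_le k l \<Longrightarrow> colist_le l m \<Longrightarrow> colist_le k m"
proof (coinduction arbitrary: k l m)
  case colist_le
  then show ?case by (cases k; cases l; cases m) auto
qed

lemma colist_le_antisym: "colist_le l m \<Longrightarrow> colist_le m l \<Longrightarrow> l = m"
proof (coinduction arbitrary: l m)
  case Eq_colist
  then show ?case by (cases l; cases m) auto
qed

lemma conat_Sup_upper: "n \<in> A \<Longrightarrow> conat_le n (conat_Sup A)"
proof (coinduction arbitrary: n A)
  case conat_le
  show ?case
  proof (cases n)
    case (cosucc k)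
    then have "conat_Sup A = cosucc (conat_Sup {n. cosucc n \<in> A})"
      using conat_le by (subst conat_Sup.code) auto
    then show ?thesis using cosucc conat_le by auto
  qed auto
qed

lemma conat_Sup_least: "(\<And>n. n \<in> A \<Longrightarrow> conat_le n u) \<Longrightarrow> conat_le (conat_Sup A) u"
proof (coinduction arbitrary: A u)
  case conat_le
  show ?case
  proof (cases "A \<subseteq> {cozero}")
    case True
    then show ?thesis by (subst conat_Sup.code) auto
  next
    case False
    then obtain k where k: "cosucc k \<in> A"
      by (metis conat.exhaust singletonI subsetI)
    with conat_le obtain v where v: "u = cosucc v"
      by (metis conat.exhaust conat_le_simps(2))
    have "conat_Sup A = cosucc (conat_Sup {n. cosucc n \<in> A})"
      using False by (subst conat_Sup.code) auto
    moreover have "\<And>n. n \<in> {n. cosucc n \<in> A} \<Longrightarrow> Defs.conat_le n v"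
      using conat_le v by fastforce
    ultimately show ?thesis using v by blast
  qed
qed

lemma colist_chain_tl:
  assumes "Complete_Partial_Order.chain colist_le A"
  shows "Complete_Partial_Order.chain colist_le {l. \<exists>a. cocons a l \<in> A}"
  using assms unfolding Complete_Partial_Order.chain_def by fastforce

lemma colist_chain_hd:
  assumes "Complete_Partial_Order.chain colist_le A" "cocons a l \<in> A"
  shows "(SOME a. \<exists>l. cocons a l \<in> A) = a"
proof (rule some_equality)
  fix b assume "\<exists>l. cocons b l \<in> A"
  with assms show "b = a" unfolding Complete_Partial_Order.chain_def by fastforce
qed (use assms in auto)

lemma colist_Sup_cocons:
  assumes "Complete_Partial_Order.chain colist_le A" "cocons a l \<in> A"
  shows "colist_Sup A = cocons a (colist_Sup {l. \<exists>a. cocons a l \<in> A})"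
  using assms(2) colist_chain_hd[OF assms] by (subst colist_Sup.code) auto

lemma colist_Sup_upper:
  "Complete_Partial_Order.chain colist_le A \<Longrightarrow> l \<in> A \<Longrightarrow> colist_le l (colist_Sup A)"
proof (coinduction arbitrary: l A)
  case colist_le
  show ?case
  proof (cases l)
    case (cocons a k)
    then show ?thesis
      using colist_le colist_Sup_cocons[of A a k] colist_chain_tl[of A] by auto
  qed auto
qed

lemma colist_Sup_least:
  "Complete_Partial_Order.chain colist_le A \<Longrightarrow> (\<And>l. l \<in> A \<Longrightarrow> colist_le l u)
    \<Longrightarrow> colist_le (colist_Sup A) u"
proof (coinduction arbitrary: A u)
  case colist_le
  show ?case
  proof (cases "A \<subseteq> {cobot}")
    case True
    then show ?thesis by (subst colist_Sup.code) auto
  next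
    case False
    then obtain a k where k: "cocons a k \<in> A"
      by (metis colist.exhaust singletonI subsetI)
    with colist_le obtain v where v: "u = cocons a v"
      by (metis colist.exhaust colist_le_simps(2,3))
    have "\<And>l. l \<in> {l. \<exists>a. cocons a l \<in> A} \<Longrightarrow> Defs.colist_le l v"
      using colist_le v by fastforce
    then show ?thesis
      using v colist_Sup_cocons[OF colist_le(1) k] colist_chain_tl[OF colist_le(1)] by blast
  qed
qed

instantiation conat :: ccpo
begin
definition less_eq_conat :: "conat \<Rightarrow> conat \<Rightarrow> bool" where "less_eq_conat = conat_le"
definition less_conat :: "conat \<Rightarrow> conat \<Rightarrow> bool" where
  "less_conat n m \<longleftrightarrow> n \<le> m \<and> \<not> m \<le> n"
definition Sup_conat :: "conat set \<Rightarrow> conat" where "Sup_conat = conat_Sup"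
instance
  by standard (auto simp: less_eq_conat_def less_conat_def Sup_conat_def
    intro: conat_le_refl conat_le_trans conat_le_antisym conat_Sup_upper conat_Sup_least)
end

instantiation colist :: (type) ccpo
begin
definition less_eq_colist :: "'a colist \<Rightarrow> 'a colist \<Rightarrow> bool" where "less_eq_colist = colist_le"
definition less_colist :: "'a colist \<Rightarrow> 'a colist \<Rightarrow> bool" where
  "less_colist l m \<longleftrightarrow> l \<le> m \<and> \<not> m \<le> l"
definition Sup_colist :: "'a colist set \<Rightarrow> 'a colist" where "Sup_colist = colist_Sup"
instance
  by standard (auto simp: less_eq_colist_def less_colist_def Sup_colist_def
    intro: colist_le_refl colist_le_trans colist_le_antisym colist_Sup_upper colist_Sup_least)
end

fun idl :: "'a colist \<Rightarrow> nat \<Rightarrow> 'a list" where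
  "idl s 0 = []"
| "idl cobot (Suc i) = []"
| "idl (cocons a s) (Suc i) = a # idl s i"

text \<open>Intended for \<open>h\<close> monotone with respect to the prefix order, so that the set is a chain;
  see \<open>chain_idl\<close> and the monotonicity lemmas below.\<close>

definition colift :: "('a list \<Rightarrow> 'c::ccpo) \<Rightarrow> 'a colist \<Rightarrow> 'c" where
  "colift h s = (SUP i. h (idl s i))"

definition colength :: "'a colist \<Rightarrow> conat" where
  "colength = colift (\<lambda>l. foldr (\<lambda>_. cosucc) l cozero)"

definition cofilter :: "('a \<Rightarrow> bool) \<Rightarrow> 'a colist \<Rightarrow> 'a colist" where
  "cofilter f = colift (\<lambda>l. foldr (\<lambda>a l. if f a then cocons a l else l) l cobot)"

primcorec nats :: "int \<Rightarrow> int colist" where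
  "nats n = cocons n (nats (n + 1))"

definition sieve_aux :: "int colist \<Rightarrow> int colist" where
  "sieve_aux = colift
     (\<lambda>l. foldr (\<lambda>n l. cocons n (cofilter (\<lambda>m. m mod n \<noteq> 0) l)) l cobot)"

definition sieve :: "int colist" where
  "sieve = sieve_aux (nats 2)"

lemma mono_cocons: "mono (cocons a)"
  by (rule monoI) (simp add: less_eq_colist_def)

lemma mono_cosucc: "mono cosucc"
  by (rule monoI) (simp add: less_eq_conat_def)

lemma cobot_least: "cobot \<le> l"
  by (simp add: less_eq_colist_def)

lemma cozero_least: "cozero \<le> n"
  by (simp add: less_eq_conat_def)

lemma prefix_idl: "i \<le> j \<Longrightarrow> prefix (idl s i) (idl s j)"
proof (induction s i arbitrary: j rule: idl.induct)
  case (2 i)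
  then show ?case by simp
next
  case (3 a s i)
  then show ?case by (cases j) auto
qed simp

lemma prefix_idl_mono: "s \<le> t \<Longrightarrow> prefix (idl s i) (idl t i)"
proof (induction s i arbitrary: t rule: idl.induct)
  case (3 a s i)
  then show ?case by (cases t) (auto simp: less_eq_colist_def)
qed simp_all

lemma chain_idl:
  fixes h :: "'a list \<Rightarrow> 'c::ccpo"
  assumes "\<And>k l. prefix k l \<Longrightarrow> h k \<le> h l"
  shows "Complete_Partial_Order.chain (\<le>) (range (\<lambda>i. h (idl s i)))"
proof (rule chainI)
  fix x y assume "x \<in> range (\<lambda>i. h (idl s i))" "y \<in> range (\<lambda>i. h (idl s i))"
  then obtain i j where "x = h (idl s i)" "y = h (idl s j)" by blast
  then show "x \<le> y \<or> y \<le> x"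
    using assms prefix_idl[of i j s] prefix_idl[of j i s] by (cases "i \<le> j") auto
qed

lemma mono_colift:
  fixes h :: "'a list \<Rightarrow> 'c::ccpo"
  assumes h: "\<And>k l. prefix k l \<Longrightarrow> h k \<le> h l"
  shows "mono (colift h)"
proof (rule monoI)
  fix s t :: "'a colist" assume "s \<le> t"
  then have "h (idl s i) \<le> (SUP i. h (idl t i))" for i
    using h prefix_idl_mono ccpo_Sup_upper[OF chain_idl[of h t]]
    by (meson order_trans rangeI)
  then show "colift h s \<le> colift h t"
    unfolding colift_def by (intro ccpo_Sup_least chain_idl h) auto
qed

lemma foldr_prefix_mono:
  fixes z :: "'c::order"
  assumes "\<And>a. mono (f a)" "\<And>x. z \<le> x" "prefix k l"
  shows "foldr f k z \<le> foldr f l z"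
  using assms(3)
proof (induction k arbitrary: l)
  case (Cons a k)
  then show ?case using assms(1) by (cases l) (auto simp: mono_def)
qed (simp add: assms(2))

lemma colength_arg_mono:
  "prefix k l \<Longrightarrow> foldr (\<lambda>_. cosucc) k cozero \<le> foldr (\<lambda>_. cosucc) l cozero"
  by (rule foldr_prefix_mono[OF mono_cosucc cozero_least])

lemma cofilter_arg_mono:
  "prefix k l \<Longrightarrow> foldr (\<lambda>a l. if f a then cocons a l else l) k cobot
    \<le> foldr (\<lambda>a l. if f a then cocons a l else l) l cobot"
  by (rule foldr_prefix_mono[OF _ cobot_least]) (auto intro!: monoI dest: monoD[OF mono_cocons])

lemma mono_cofilter: "mono (cofilter f)"
  unfolding cofilter_def by (rule mono_colift) (rule cofilter_arg_mono)

lemma sieve_aux_arg_mono: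
  "prefix k l \<Longrightarrow> foldr (\<lambda>n l. cocons n (cofilter (\<lambda>m. m mod n \<noteq> 0) l)) k cobot
    \<le> foldr (\<lambda>n l. cocons n (cofilter (\<lambda>m. m mod (n::int) \<noteq> 0) l)) l cobot"
  by (rule foldr_prefix_mono[OF _ cobot_least])
    (auto intro!: monoI monoD[OF mono_cocons] monoD[OF mono_cofilter])

end

theory Submission
  imports Defs "HOL-Computational_Algebra.Primes"
begin

text \<open>On a finite list every lifted fold takes its list-level value, so the finite approximations
  of the sieve are computed by an ordinary sieve on lists. On a list of integers \<open>\<ge> 2\<close> this sieve
  keeps all primes of the list, since it discards only proper multiples. As there are infinitely
  many primes, the approximations are arbitrarily long, and \<open>\<omega>\<close> is the only conat above all
  finite ones.\<close>

text \<open>Ending in \<open>cobot\<close> makes these the finite partial colists, the values taken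
  by folds that start at \<open>cobot\<close>.\<close>

definition colist_of :: "'a list \<Rightarrow> 'a colist" where
  "colist_of l = foldr cocons l cobot"

lemma colist_of_simps [simp]:
  "colist_of [] = cobot"
  "colist_of (a # l) = cocons a (colist_of l)"
  by (simp_all add: colist_of_def)

lemma idl_colist_of: "idl (colist_of l) i = take i l"
proof (induction l arbitrary: i)
  case Nil
  then show ?case by (cases i) auto
next
  case (Cons a l)
  then show ?case by (cases i) auto
qed

lemma colift_upper:
  fixes h :: "'a list \<Rightarrow> 'c::ccpo"
  assumes "\<And>k l. prefix k l \<Longrightarrow> h k \<le> h l"
  shows "h (idl s i) \<le> colift h s"
  unfolding colift_def by (rule ccpo_Sup_upper[OF chain_idl[OF assms]]) auto

text \<open>The approximations of \<open>colist_of l\<close> are the prefixes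
  \<open>take i l\<close>, so by monotonicity \<open>h l\<close> bounds the chain, and it is
  attained at index \<open>length l\<close>.\<close>

lemma colift_colist_of:
  fixes h :: "'a list \<Rightarrow> 'c::ccpo"
  assumes h: "\<And>k l. prefix k l \<Longrightarrow> h k \<le> h l"
  shows "colift h (colist_of l) = h l"
proof (rule antisym)
  show "colift h (colist_of l) \<le> h l"
    unfolding colift_def
    by (intro ccpo_Sup_least chain_idl h) (auto simp: idl_colist_of intro!: h take_is_prefix)
  show "h l \<le> colift h (colist_of l)"
    using colift_upper[of h "colist_of l" "length l"] h by (simp add: idl_colist_of)
qed

lemma cofilter_colist_of: "cofilter f (colist_of l) = colist_of (filter f l)"
proof -
  have "cofilter f (colist_of l) = foldr (\<lambda>a l. if f a then cocons a l else l) l cobot"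
    unfolding cofilter_def by (rule colift_colist_of) (rule cofilter_arg_mono)
  also have "\<dots> = colist_of (filter f l)"
    by (induction l) auto
  finally show ?thesis .
qed

lemma colength_colist_of: "colength (colist_of l) = (cosucc ^^ length l) cozero"
proof -
  have "colength (colist_of l) = foldr (\<lambda>_. cosucc) l cozero"
    unfolding colength_def by (rule colift_colist_of) (rule colength_arg_mono)
  also have "\<dots> = (cosucc ^^ length l) cozero"
    by (induction l) auto
  finally show ?thesis .
qed

lemma mono_colength: "mono colength"
  unfolding colength_def by (rule mono_colift) (rule colength_arg_mono)

lemma conat_omega_unique:
  assumes "\<And>n. (cosucc ^^ n) cozero \<le> x"
  shows "x = conat_omega"
  using assms
proof (coinduction arbitrary: x)
  case Eq_conat
  \<comment> \<open>The bound at \<open>Suc n\<close> rules out \<open>x = cozero\<close>;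
    cancelling one \<open>cosucc\<close> gives the predecessor of \<open>x\<close> the same
    hypothesis, which closes the bisimulation.\<close>
  have "(cosucc ^^ Suc n) cozero \<le> x" for n
    using Eq_conat by blast
  then show ?case
    by (cases x) (auto simp: less_eq_conat_def)
qed

text \<open>The tail is sieved before multiples of the head are removed, the same order as in the
  fold behind \<open>sieve_aux\<close>.\<close>

fun list_sieve :: "int list \<Rightarrow> int list" where
  "list_sieve [] = []"
| "list_sieve (n # l) = n # filter (\<lambda>m. m mod n \<noteq> 0) (list_sieve l)"

lemma foldr_sieve_eq_list_sieve:
  "foldr (\<lambda>n l. cocons n (cofilter (\<lambda>m. m mod n \<noteq> 0) l)) l cobot = colist_of (list_sieve l)"
  by (induction l) (auto simp: cofilter_colist_of)

lemma prime_in_list_sieve: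
  assumes "\<forall>n\<in>set l. 2 \<le> n" "p \<in> set l" "prime p"
  shows "p \<in> set (list_sieve l)"
  using assms
proof (induction l)
  case (Cons n l)
  show ?case
  proof (cases "p = n")
    case False
    moreover have "2 \<le> n"
      using Cons.prems by simp
    \<comment> \<open>The only nonnegative divisors of the prime \<open>p\<close> are 1 and
      \<open>p\<close>; the bound \<open>2 \<le> n\<close> excludes the first,
      \<open>p \<noteq> n\<close> the second.\<close>
    ultimately have "\<not> n dvd p"
      using \<open>prime p\<close> unfolding prime_int_iff by (auto dest!: spec[of _ n])
    then show ?thesis
      using Cons False by (auto simp: dvd_eq_mod_eq_0)
  qed simp
qed simp

lemma set_idl_nats: "set (idl (nats n) i) = {n..<n + int i}"
proof (induction i arbitrary: n)
  case (Suc i)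
  have "set (idl (nats n) (Suc i)) = insert n {n + 1..<n + 1 + int i}"
    by (subst nats.code) (simp add: Suc)
  also have "\<dots> = {n..<n + int (Suc i)}"
    by auto
  finally show ?case .
qed simp

text \<open>The left side is the term at index \<open>i\<close> of the chain whose supremum is
  \<open>sieve\<close>.\<close>

lemma colist_of_list_sieve_le_sieve: "colist_of (list_sieve (idl (nats 2) i)) \<le> sieve"
  unfolding sieve_def sieve_aux_def foldr_sieve_eq_list_sieve[symmetric]
  by (rule colift_upper[where h = "\<lambda>l. foldr _ l _"]) (rule sieve_aux_arg_mono)

lemma length_list_sieve_unbounded: "\<exists>i. k \<le> length (list_sieve (idl (nats 2) i))"
proof -
  obtain P :: "nat set" where P: "P \<subseteq> {p. prime p}" "finite P" "card P = k"
    using infinite_arbitrarily_large[OF primes_infinite] by blast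
  \<comment> \<open>The first \<open>i\<close> entries of \<open>nats 2\<close> run from 2 to
    \<open>i + 1\<close>, which exceeds \<open>Max P\<close>, so they include all of
    \<open>P\<close>.\<close>
  define i where "i = Suc (Max P)"
  have "int ` P \<subseteq> set (list_sieve (idl (nats 2) i))"
  proof
    fix q assume "q \<in> int ` P"
    then obtain p where p: "p \<in> P" "q = int p" by blast
    have "prime p" "p \<le> Max P"
      using P p by auto
    then show "q \<in> set (list_sieve (idl (nats 2) i))"
      using p prime_ge_2_nat[of p]
      by (intro prime_in_list_sieve) (auto simp: set_idl_nats i_def)
  qed
  \<comment> \<open>The \<open>k\<close> surviving primes are distinct, so counting distinct entries
    bounds the length from below.\<close>
  then have "card (int ` P) \<le> card (set (list_sieve (idl (nats 2) i)))"
    by (rule card_mono[rotated]) simp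
  also have "\<dots> \<le> length (list_sieve (idl (nats 2) i))"
    by (rule card_length)
  finally show ?thesis
    using P(3) by (auto simp: card_image)
qed

lemma funpow_cosucc_mono:
  assumes "m \<le> n"
  shows "(cosucc ^^ m) cozero \<le> (cosucc ^^ n) cozero"
  using funpow_mono2[OF mono_cosucc assms] cozero_least by blast

theorem mainTheorem9: "colength sieve = conat_omega"
proof (rule conat_omega_unique)
  fix k
  obtain i where i: "k \<le> length (list_sieve (idl (nats 2) i))"
    using length_list_sieve_unbounded by blast
  have "(cosucc ^^ k) cozero \<le> colength (colist_of (list_sieve (idl (nats 2) i)))"
    unfolding colength_colist_of using i by (rule funpow_cosucc_mono)
  also have "\<dots> \<le> colength sieve"
    by (rule monoD[OF mono_colength colist_of_list_sieve_le_sieve])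
  finally show "(cosucc ^^ k) cozero \<le> colength sieve" .
qed

end
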